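(* Consider an instance $(A,B,D,\delta,W)$ of the circuit switch scheduling problem with $\delta>0$, and let $\mathcal{S}_r$ be the schedule returned by the greedy algorithm described below. Let $\mathcal{O}$ be an optimal feasible schedule (for time window $W$). Then $$f(\mathcal{S}_r)\geq\left(1-\frac{2\delta}{W}\right)\left(1-\frac1e\right)f(\mathcal{O}).$$
   Context: Circuit switch scheduling problem: $A,B$ finite disjoint sets, $E=A\times B$ the edges of the complete bipartite graph on $A\cup B$, $D\in\mathbb{R}_{\geq0}^{A\times B}$ a demand matrix, $\delta\geq0$ a switching delay, $W\geq 0$ a time window. A matching is a set of pairwise vertex-disjoint edges. A configuration is a pair $(M,\alpha)$ with $M$ a matching and $\alpha\in\mathbb{R}_{\geq0}$; a schedule is a finite set $S$ of configurations, feasible if $\sum_{(M,\alpha)\in S}(\alpha+\delta)\leq W$; its value is $f(S)=\sum_{e\in E}\min(D_e,\sum_{(M,\alpha)\in S: e\in M}\alpha)$. For a matrix $R$ and configuration $(M,\alpha)$ write $\|\min(R,\alpha M)\|_1=\sum_{e\in M}\min(R_e,\alpha)$. Greedy algorithm: set $S=\emptyset$, $i=0$, $R_1=D$. While $\sum_{(M,\alpha)\in S}(\alpha+\delta)\leq W$: set $i\gets i+1$; choose $(M_i,\alpha_i)$ maximizing $\frac{\|\min(R_i,\alpha M)\|_1}{\alpha+\delta}$ over all matchings $M$ and all $\alpha\geq0$; add $(M_i,\alpha_i)$ to $S$; let $R_{i+1}$ be obtained from $R_i$ by decreasing $R_{i,e}$ by $\min(R_{i,e},\alpha_i)$ for each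 $e\in M_i$. Let $r$ be the final value of $i$. If $\sum_{(M,\alpha)\in S}(\alpha+\delta)>W$, let $\beta_r=W-\delta-\sum_{j=1}^{r-1}(\alpha_j+\delta)$; if $\beta_r\geq0$ replace $(M_r,\alpha_r)$ by $(M_r,\beta_r)$ in $S$, otherwise remove $(M_r,\alpha_r)$ from $S$. The output $\mathcal{S}_r$ is the resulting $S$.
   Formalization: Schedules are finite multisets of configurations rather than sets, so a configuration that the greedy algorithm selects repeatedly counts each time; with literal sets repeated selections collapse and the bound can fail. The optimal value is the same for sets and multisets. *)

theory Defs
  imports Complex_Main "HOL-Library.Multiset"
begin

type_synonym 'v edge = "'v \<times> 'v"
type_synonym 'v config = "'v edge set \<times> real"

definition matching :: "'v set \<Rightarrow> 'v set \<Rightarrow> 'v edge set \<Rightarrow> bool" where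
  "matching A B M \<longleftrightarrow> M \<subseteq> A \<times> B \<and>
     (\<forall>e\<in>M. \<forall>e'\<in>M. e \<noteq> e' \<longrightarrow> {fst e, snd e} \<inter> {fst e', snd e'} = {})"

definition configuration :: "'v set \<Rightarrow> 'v set \<Rightarrow> 'v config \<Rightarrow> bool" where
  "configuration A B c \<longleftrightarrow> matching A B (fst c) \<and> 0 \<le> snd c"

text \<open>
  Schedules are finite collections of configurations, counted with multiplicity: the greedy
  algorithm may select the same pair \<open>(M, \<alpha>)\<close> in several iterations, and each selection takes up
  time and serves demand. With genuine sets the repeated selections would collapse to one (and the
  approximation guarantee would fail). For optimal schedules the distinction is immaterial, see
  \<open>feasible_schedule_as_set\<close> below.
\<close>

definition duration :: "real \<Rightarrow> 'v config multiset \<Rightarrow> real" where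
  "duration \<delta> S = (\<Sum>(M, \<alpha>)\<in>#S. \<alpha> + \<delta>)"

definition feasible_schedule ::
    "'v set \<Rightarrow> 'v set \<Rightarrow> real \<Rightarrow> real \<Rightarrow> 'v config multiset \<Rightarrow> bool" where
  "feasible_schedule A B \<delta> W S \<longleftrightarrow> (\<forall>c\<in>#S. configuration A B c) \<and> duration \<delta> S \<le> W"

definition schedule_value ::
    "'v set \<Rightarrow> 'v set \<Rightarrow> ('v edge \<Rightarrow> real) \<Rightarrow> 'v config multiset \<Rightarrow> real" where
  "schedule_value A B D S =
     (\<Sum>e\<in>A \<times> B. min (D e) (\<Sum>(M, \<alpha>)\<in>#{#c \<in># S. e \<in> fst c#}. \<alpha>))"

definition optimal_schedule ::
    "'v set \<Rightarrow> 'v set \<Rightarrow> ('v edge \<Rightarrow> real) \<Rightarrow> real \<Rightarrow> real \<Rightarrow> 'v config multiset \<Rightarrow> bool" where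
  "optimal_schedule A B D \<delta> W S \<longleftrightarrow>
     is_arg_max (schedule_value A B D) (feasible_schedule A B \<delta> W) S"

definition served :: "('v edge \<Rightarrow> real) \<Rightarrow> 'v config \<Rightarrow> real" where
  "served R c = (\<Sum>e\<in>fst c. min (R e) (snd c))"

definition greedy_choice ::
    "'v set \<Rightarrow> 'v set \<Rightarrow> real \<Rightarrow> ('v edge \<Rightarrow> real) \<Rightarrow> 'v config \<Rightarrow> bool" where
  "greedy_choice A B \<delta> R c \<longleftrightarrow>
     is_arg_max (\<lambda>c. served R c / (snd c + \<delta>)) (configuration A B) c"

definition residual :: "('v edge \<Rightarrow> real) \<Rightarrow> 'v config \<Rightarrow> 'v edge \<Rightarrow> real" where
  "residual R c = (\<lambda>e. if e \<in> fst c then R e - min (R e) (snd c) else R e)"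

text \<open>
  \<open>greedy_reach A B D \<delta> W cs R\<close>: some execution of the loop (ties between maximizers are broken
  arbitrarily) has, after \<open>i = length cs\<close> iterations, selected the configurations \<open>cs\<close> in this order
  and has the current residual demand \<open>R\<close>, i.e. \<open>R\<^bsub>i+1\<^esub>\<close>.
\<close>

inductive greedy_reach ::
    "'v set \<Rightarrow> 'v set \<Rightarrow> ('v edge \<Rightarrow> real) \<Rightarrow> real \<Rightarrow> real \<Rightarrow>
     'v config list \<Rightarrow> ('v edge \<Rightarrow> real) \<Rightarrow> bool"
  for A B D \<delta> W where
  init: "greedy_reach A B D \<delta> W [] D"
| step: "greedy_reach A B D \<delta> W cs R \<Longrightarrow> duration \<delta> (mset cs) \<le> W \<Longrightarrow>
         greedy_choice A B \<delta> R c \<Longrightarrow>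
         greedy_reach A B D \<delta> W (cs @ [c]) (residual R c)"

definition truncate_last :: "real \<Rightarrow> real \<Rightarrow> 'v config list \<Rightarrow> 'v config multiset" where
  "truncate_last \<delta> W cs =
     (if duration \<delta> (mset cs) > W then
        (let \<beta> = W - \<delta> - duration \<delta> (mset (butlast cs))
         in if \<beta> \<ge> 0 then mset (butlast cs) + {#(fst (last cs), \<beta>)#} else mset (butlast cs))
      else mset cs)"

definition greedy_output ::
    "'v set \<Rightarrow> 'v set \<Rightarrow> ('v edge \<Rightarrow> real) \<Rightarrow> real \<Rightarrow> real \<Rightarrow> 'v config multiset \<Rightarrow> bool" where
  "greedy_output A B D \<delta> W S \<longleftrightarrow>
     (\<exists>cs R. greedy_reach A B D \<delta> W cs R \<and> \<not> duration \<delta> (mset cs) \<le> W \<and>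
        S = truncate_last \<delta> W cs)"

text \<open>Merging the configurations with equal matching shows that multiplicities gain nothing.\<close>

lemma sum_mset_group_fst:
  fixes h :: "'a \<times> 'b \<Rightarrow> real"
  assumes "finite F" "fst ` set_mset S \<subseteq> F"
  shows "(\<Sum>x\<in>F. \<Sum>c\<in>#{#c \<in># S. fst c = x#}. h c) = (\<Sum>c\<in>#S. h c)"
  using assms(2)
proof (induction S)
  case (add c S)
  have "(\<Sum>x\<in>F. \<Sum>c\<in>#{#d \<in># add_mset c S. fst d = x#}. h c)
      = (\<Sum>x\<in>F. (if fst c = x then h c else 0) + (\<Sum>c\<in>#{#d \<in># S. fst d = x#}. h c))"
    by (rule sum.cong) auto
  also have "\<dots> = h c + (\<Sum>c\<in>#S. h c)"
    using add assms(1) by (simp add: sum.distrib sum.delta)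
  finally show ?case by simp
qed simp

lemma feasible_schedule_as_set:
  fixes S :: "'v config multiset"
  assumes "0 \<le> \<delta>" "feasible_schedule A B \<delta> W S"
  shows "\<exists>T. finite T \<and> feasible_schedule A B \<delta> W (mset_set T) \<and>
             schedule_value A B D (mset_set T) = schedule_value A B D S"
proof -
  define F where "F = fst ` set_mset S"
  define t where "t M = (\<Sum>c\<in>#{#c \<in># S. fst c = M#}. snd c)" for M
  define T where "T = (\<lambda>M. (M, t M)) ` F"
  have fin: "finite F" "finite T" by (auto simp: F_def T_def)
  have conf: "configuration A B c" if "c \<in># S" for c
    using assms(2) that by (auto simp: feasible_schedule_def)
  have "0 \<le> (\<Sum>c\<in>#X. snd c)" if "\<forall>c\<in>#X. 0 \<le> snd c" for X :: "'v config multiset"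
    using that by (induction X) auto
  then have t_nonneg: "0 \<le> t M" for M
    unfolding t_def using conf by (auto simp: configuration_def)
  have conf_T: "configuration A B c" if "c \<in> T" for c
    using that t_nonneg by (auto simp: T_def F_def configuration_def dest: conf)
  have "duration \<delta> (mset_set T) = (\<Sum>c\<in>T. snd c + \<delta>)"
    by (simp add: duration_def sum_unfold_sum_mset case_prod_unfold)
  also have "\<dots> = (\<Sum>M\<in>F. t M + \<delta>)"
    unfolding T_def by (subst sum.reindex) (auto simp: inj_on_def)
  also have "\<dots> \<le> (\<Sum>M\<in>F. \<Sum>c\<in>#{#c \<in># S. fst c = M#}. snd c + \<delta>)"
  proof (rule sum_mono)
    fix M assume "M \<in> F"
    then have "{#c \<in># S. fst c = M#} \<noteq> {#}"
      by (auto simp: F_def)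
    then have "1 \<le> size {#c \<in># S. fst c = M#}"
      unfolding nonempty_has_size by linarith
    then have "\<delta> \<le> real (size {#c \<in># S. fst c = M#}) * \<delta>"
      using assms(1) mult_right_mono[of 1 "real (size {#c \<in># S. fst c = M#})" \<delta>] by simp
    then show "t M + \<delta> \<le> (\<Sum>c\<in>#{#c \<in># S. fst c = M#}. snd c + \<delta>)"
      by (simp add: t_def sum_mset.distrib)
  qed
  also have "\<dots> = duration \<delta> S"
    using sum_mset_group_fst[OF fin(1), of S "\<lambda>c. snd c + \<delta>"]
    by (simp add: F_def duration_def case_prod_unfold)
  finally have dur: "duration \<delta> (mset_set T) \<le> W"
    using assms(2) by (simp add: feasible_schedule_def)
  have "(\<Sum>(M, \<alpha>)\<in>#{#c \<in># mset_set T. e \<in> fst c#}. \<alpha>) = (\<Sum>(M, \<alpha>)\<in>#{#c \<in># S. e \<in> fst c#}. \<alpha>)"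
    for e
  proof -
    have "(\<Sum>(M, \<alpha>)\<in>#{#c \<in># mset_set T. e \<in> fst c#}. \<alpha>) = (\<Sum>c\<in>{c \<in> T. e \<in> fst c}. snd c)"
      using fin by (simp add: sum_unfold_sum_mset case_prod_unfold)
    also have "\<dots> = (\<Sum>M\<in>{M \<in> F. e \<in> M}. t M)"
    proof -
      have "{c \<in> T. e \<in> fst c} = (\<lambda>M. (M, t M)) ` {M \<in> F. e \<in> M}"
        unfolding T_def Compr_image_eq by simp
      moreover have "inj_on (\<lambda>M. (M, t M)) {M \<in> F. e \<in> M}"
        by (simp add: inj_on_def)
      ultimately show ?thesis by (simp only: sum.reindex comp_def snd_conv)
    qed
    also have "\<dots> = (\<Sum>M\<in>{M \<in> F. e \<in> M}. \<Sum>c\<in>#{#c \<in># {#c \<in># S. e \<in> fst c#}. fst c = M#}. snd c)"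
    proof (rule sum.cong)
      fix M assume "M \<in> {M \<in> F. e \<in> M}"
      then have "{#c \<in># S. fst c = M#} = {#c \<in># {#c \<in># S. e \<in> fst c#}. fst c = M#}"
        unfolding filter_filter_mset by (intro filter_mset_cong refl) auto
      then show "t M = (\<Sum>c\<in>#{#c \<in># {#c \<in># S. e \<in> fst c#}. fst c = M#}. snd c)"
        by (simp only: t_def)
    qed simp
    also have "\<dots> = (\<Sum>c\<in>#{#c \<in># S. e \<in> fst c#}. snd c)"
      by (rule sum_mset_group_fst) (auto simp: F_def)
    finally show ?thesis by (simp add: case_prod_unfold)
  qed
  then show ?thesis
    using fin conf_T dur
    by (intro exI[of _ T]) (simp add: feasible_schedule_def schedule_value_def)
qed

end

theory Submission
  imports Defs
begin

text \<open>
  The gain of adding a configuration \<open>c\<close> to a schedule \<open>S\<close> is \<open>served R c\<close>, where \<open>R\<close> is what \<open>S\<close>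
  leaves of the demand, and this gain decreases as \<open>S\<close> grows. Adding the configurations of an optimal
  schedule one by one to \<open>S\<close> therefore shows that the best ratio of gain to time is at least
  \<open>gap / W\<close>, where \<open>gap\<close> is the difference between the optimal value and the value of \<open>S\<close>. Hence a
  greedy configuration of duration \<open>\<tau>\<close> shrinks the gap by a factor of at most \<open>exp (- \<tau> / W)\<close>.
  Truncating the last configuration to length \<open>\<beta>\<close> still shrinks it by \<open>exp (- \<beta> / W)\<close>, only the
  final delay \<open>\<delta>\<close> being lost, so the output misses at most \<open>exp (- (W - \<delta>) / W)\<close> of the optimum.
\<close>

section \<open>Loads, unserved demand and marginal gains\<close>

definition load :: "'v config multiset \<Rightarrow> 'v edge \<Rightarrow> real" where
  "load S e = (\<Sum>(M, \<alpha>)\<in>#{#c \<in># S. e \<in> fst c#}. \<alpha>)"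

text \<open>The positive part of \<open>D e - load S e\<close>: a closed form for the greedy
  residual that depends only on total loads, not on the order of selection.\<close>

definition unserved :: "('v edge \<Rightarrow> real) \<Rightarrow> 'v config multiset \<Rightarrow> 'v edge \<Rightarrow> real" where
  "unserved D S e = D e - min (D e) (load S e)"

lemma schedule_value_load: "schedule_value A B D S = (\<Sum>e\<in>A \<times> B. min (D e) (load S e))"
  by (simp add: schedule_value_def load_def)

lemma load_empty [simp]: "load {#} e = 0"
  by (simp add: load_def)

lemma load_add_mset [simp]:
  "load (add_mset c S) e = (if e \<in> fst c then snd c else 0) + load S e"
  by (simp add: load_def case_prod_unfold)

lemma load_union: "load (S + T) e = load S e + load T e"
  by (simp add: load_def)

lemma load_nonneg: "\<forall>c\<in>#S. configuration A B c \<Longrightarrow> 0 \<le> load S e"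
  by (induction S) (auto simp: configuration_def)

lemma duration_empty [simp]: "duration \<delta> {#} = 0"
  by (simp add: duration_def)

lemma duration_add_mset [simp]: "duration \<delta> (add_mset c S) = snd c + \<delta> + duration \<delta> S"
  by (simp add: duration_def case_prod_unfold)

lemma unserved_nonneg: "0 \<le> unserved D S e"
  by (simp add: unserved_def)

lemma unserved_empty: "0 \<le> D e \<Longrightarrow> unserved D {#} e = D e"
  by (simp add: unserved_def)

text \<open>Subtracting \<open>snd c\<close> from a positive part and stopping at 0 yields the
  positive part of the reduced difference, because \<open>snd c\<close> is nonnegative.\<close>

lemma residual_unserved:
  assumes "0 \<le> snd c"
  shows "residual (unserved D S) c = unserved D (add_mset c S)"
  using assms by (auto simp: residual_def unserved_def fun_eq_iff min_def)

lemma served_cong: "(\<And>e. e \<in> fst c \<Longrightarrow> R e = R' e) \<Longrightarrow> served R c = served R' c"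
  by (simp add: served_def)

lemma served_unserved_nonneg: "0 \<le> snd c \<Longrightarrow> 0 \<le> served (unserved D S) c"
  by (auto simp: served_def unserved_nonneg intro!: sum_nonneg)

text \<open>On an edge of \<open>fst c\<close>, raising the load by \<open>snd c\<close> raises
  \<open>min (D e) (load S e)\<close> by \<open>min (unserved D S e) (snd c)\<close>; other edges do
  not change.\<close>

lemma schedule_value_add_mset:
  assumes "finite A" "finite B" "configuration A B c"
  shows "schedule_value A B D (add_mset c S) = schedule_value A B D S + served (unserved D S) c"
proof -
  have c: "fst c \<subseteq> A \<times> B" "0 \<le> snd c"
    using assms(3) by (auto simp: configuration_def matching_def)
  have "schedule_value A B D (add_mset c S)
      = (\<Sum>e\<in>A \<times> B. min (D e) (load S e) + (if e \<in> fst c then min (unserved D S e) (snd c) else 0))"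
    unfolding schedule_value_load using c(2)
    by (intro sum.cong) (auto simp: unserved_def min_def)
  also have "\<dots> = schedule_value A B D S + (\<Sum>e\<in>(A \<times> B) \<inter> fst c. min (unserved D S e) (snd c))"
    using assms(1,2) by (simp add: sum.distrib schedule_value_load sum.inter_restrict)
  also have "(A \<times> B) \<inter> fst c = fst c" using c(1) by blast
  finally show ?thesis by (simp add: served_def)
qed

lemma schedule_value_nonneg:
  assumes "\<And>e. e \<in> A \<times> B \<Longrightarrow> 0 \<le> D e" "\<forall>c\<in>#S. configuration A B c"
  shows "0 \<le> schedule_value A B D S"
  unfolding schedule_value_load using assms load_nonneg[OF assms(2)] by (auto intro!: sum_nonneg)

text \<open>Submodularity: loads are nonnegative, so what \<open>S + T\<close> leaves unserved is at
  most what \<open>S\<close> leaves, and each element of \<open>T\<close> gains at most what it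
  would gain on top of \<open>S\<close> alone.\<close>

lemma schedule_value_le_served:
  assumes "finite A" "finite B" "\<forall>c\<in>#S. configuration A B c" "\<forall>c\<in>#T. configuration A B c"
  shows "schedule_value A B D T \<le> schedule_value A B D S + (\<Sum>c\<in>#T. served (unserved D S) c)"
proof -
  have "schedule_value A B D (S + T) \<le> schedule_value A B D S + (\<Sum>c\<in>#T. served (unserved D S) c)"
    using assms(4)
  proof (induction T)
    case (add c T)
    have "unserved D (S + T) e \<le> unserved D S e" for e
      using load_nonneg[of T A B e] add.prems by (auto simp: unserved_def load_union)
    then have "served (unserved D (S + T)) c \<le> served (unserved D S) c"
      unfolding served_def by (intro sum_mono min.mono) auto
    then show ?case
      using add schedule_value_add_mset[OF assms(1,2), of c D "S + T"] by simp
  qed simp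
  moreover have "schedule_value A B D T \<le> schedule_value A B D (S + T)"
    unfolding schedule_value_load load_union
    using load_nonneg[OF assms(3)] by (intro sum_mono min.mono) auto
  ultimately show ?thesis by linarith
qed

section \<open>Greedy choices and the decay of the gap\<close>

lemma greedy_choice_served_ge:
  assumes "finite A" "finite B" "\<delta> > 0" "W > 0"
    and "\<forall>c\<in>#S. configuration A B c" "feasible_schedule A B \<delta> W T"
    and R: "\<And>e. e \<in> A \<times> B \<Longrightarrow> R e = unserved D S e" and c: "greedy_choice A B \<delta> R c"
  shows "served (unserved D S) c
    \<ge> (snd c + \<delta>) / W * (schedule_value A B D T - schedule_value A B D S)"
proof -
  \<comment> \<open>\<open>R\<close> is known only on \<open>A \<times> B\<close>: elsewhere
    \<open>D\<close> may be negative, and then the initial residual \<open>D\<close> differs from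
    \<open>unserved D {#}\<close>. Matchings never leave \<open>A \<times> B\<close>.\<close>
  have conf_served: "served R x = served (unserved D S) x" if "configuration A B x" for x
    using that R by (intro served_cong) (auto simp: configuration_def matching_def)
  have cc: "configuration A B c" using c by (simp add: greedy_choice_def is_arg_max_def)
  then have pos: "0 < snd c + \<delta>" "0 \<le> snd c" using assms(3) by (auto simp: configuration_def)
  \<comment> \<open>The best gain per unit of time; all of \<open>T\<close> then gains at most
    \<open>\<rho> * W\<close> on top of \<open>S\<close>.\<close>
  define \<rho> where "\<rho> = served (unserved D S) c / (snd c + \<delta>)"
  have \<rho>: "0 \<le> \<rho>" using pos served_unserved_nonneg[of c D S] by (simp add: \<rho>_def)
  have max: "served (unserved D S) x \<le> \<rho> * (snd x + \<delta>)" if x: "configuration A B x" for x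
  proof -
    have "served R x / (snd x + \<delta>) \<le> served R c / (snd c + \<delta>)"
      using c x unfolding greedy_choice_def is_arg_max_def by (meson not_less)
    moreover have "0 < snd x + \<delta>" using x assms(3) by (auto simp: configuration_def)
    ultimately show ?thesis
      using conf_served[OF x] conf_served[OF cc] by (simp add: \<rho>_def pos_divide_le_eq)
  qed
  have T: "\<forall>c\<in>#T. configuration A B c" "duration \<delta> T \<le> W"
    using assms(6) by (auto simp: feasible_schedule_def)
  have "(\<Sum>x\<in>#T. served (unserved D S) x) \<le> \<rho> * duration \<delta> T"
    using T(1)
  proof (induction T)
    case (add x T)
    then show ?case using max[of x] by (simp add: algebra_simps)
  qed simp
  also have "\<dots> \<le> \<rho> * W" using \<rho> T(2) by (rule mult_left_mono[rotated])
  finally have "schedule_value A B D T - schedule_value A B D S \<le> \<rho> * W"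
    using schedule_value_le_served[OF assms(1,2,5) T(1), of D] by linarith
  then have "(schedule_value A B D T - schedule_value A B D S) * ((snd c + \<delta>) / W)
      \<le> \<rho> * W * ((snd c + \<delta>) / W)"
    using pos assms(4) by (intro mult_right_mono) auto
  also have "\<dots> = served (unserved D S) c" using pos assms(4) by (simp add: \<rho>_def)
  finally show ?thesis by (simp add: mult.commute)
qed

text \<open>Scaling by \<open>t \<le> 1\<close> with \<open>t * snd c \<le> \<beta>\<close> keeps
  each term below both \<open>R e\<close> and \<beta>. The denominator includes \<delta> so as to
  cancel the factor \<open>snd c + \<delta>\<close> in the greedy bound.\<close>

lemma served_truncate_ge:
  assumes "0 \<le> \<beta>" "\<beta> \<le> snd c" "\<delta> > 0" "\<And>e. 0 \<le> R e"
  shows "served R (fst c, \<beta>) \<ge> \<beta> / (snd c + \<delta>) * served R c"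
proof -
  define t where "t = \<beta> / (snd c + \<delta>)"
  have t: "0 \<le> t" "t \<le> 1" using assms by (auto simp: t_def)
  have "t * snd c \<le> t * (snd c + \<delta>)" using t assms(3) by (intro mult_left_mono) auto
  also have "\<dots> = \<beta>" using assms by (simp add: t_def)
  finally have "t * snd c \<le> \<beta>" .
  moreover have "t * R e \<le> R e" for e
    using t assms(4)[of e] mult_right_mono[of t 1 "R e"] by simp
  moreover have "t * min (R e) (snd c) \<le> t * R e" "t * min (R e) (snd c) \<le> t * snd c" for e
    using t(1) by (auto intro: mult_left_mono)
  ultimately have "t * min (R e) (snd c) \<le> min (R e) \<beta>" for e
    by (meson min.boundedI order_trans)
  then show ?thesis
    unfolding served_def t_def[symmetric] by (simp add: sum_distrib_left sum_mono)
qed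

text \<open>For a nonnegative gap this is \<open>1 + x \<le> exp x\<close> at
  \<open>x = - \<tau> / W\<close>. A negative gap stays negative since \<open>g \<ge> 0\<close>,
  while the right-hand side is nonnegative.\<close>

lemma gap_contraction:
  fixes gap W :: real
  assumes "W > 0" "V \<ge> 0" "gap \<le> V * exp (- t / W)" "g \<ge> \<tau> / W * gap" "g \<ge> 0"
  shows "gap - g \<le> V * exp (- (t + \<tau>) / W)"
proof (cases "gap \<ge> 0")
  case True
  have "gap - g \<le> gap * (1 + (- \<tau> / W))" using assms(4) by (simp add: algebra_simps)
  also have "\<dots> \<le> gap * exp (- \<tau> / W)" using True by (intro mult_left_mono exp_ge_add_one_self)
  also have "\<dots> \<le> V * exp (- t / W) * exp (- \<tau> / W)" using assms(3) by (intro mult_right_mono) auto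
  also have "\<dots> = V * exp (- (t + \<tau>) / W)"
    by (simp add: mult.assoc flip: exp_add) (simp add: diff_divide_distrib)
  finally show ?thesis .
next
  case False
  moreover have "0 \<le> V * exp (- (t + \<tau>) / W)" using assms(2) by simp
  ultimately show ?thesis using assms(5) by linarith
qed

text \<open>Each iteration contracts the gap with \<open>\<tau> = snd c + \<delta>\<close>, so the
  exponents add up to the total duration.\<close>

lemma greedy_reach_invariant:
  assumes "greedy_reach A B D \<delta> W cs R"
    and "finite A" "finite B" "\<And>e. e \<in> A \<times> B \<Longrightarrow> 0 \<le> D e" "\<delta> > 0" "W > 0"
    and T: "feasible_schedule A B \<delta> W T"
  shows "(\<forall>c\<in>#mset cs. configuration A B c) \<and> (\<forall>e\<in>A \<times> B. R e = unserved D (mset cs) e) \<and>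
    schedule_value A B D T - schedule_value A B D (mset cs)
      \<le> schedule_value A B D T * exp (- duration \<delta> (mset cs) / W)"
  using assms(1)
proof induction
  case init
  have "0 \<le> schedule_value A B D {#}" using assms(4) by (intro schedule_value_nonneg) auto
  then show ?case using assms(4) by (auto simp: unserved_empty)
next
  case (step cs R c)
  let ?S = "mset cs"
  have cs: "\<forall>c\<in>#?S. configuration A B c" and R: "\<And>e. e \<in> A \<times> B \<Longrightarrow> R e = unserved D ?S e"
    using step.IH by auto
  have cc: "configuration A B c" using step.hyps by (simp add: greedy_choice_def is_arg_max_def)
  then have c0: "0 \<le> snd c" by (simp add: configuration_def)
  have "residual R c e = unserved D (add_mset c ?S) e" if "e \<in> A \<times> B" for e
    using R[OF that] by (simp add: residual_def flip: residual_unserved[OF c0])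
  moreover have "0 \<le> schedule_value A B D T"
    using T assms(4) by (intro schedule_value_nonneg) (auto simp: feasible_schedule_def)
  then have "schedule_value A B D T - schedule_value A B D ?S - served (unserved D ?S) c
      \<le> schedule_value A B D T * exp (- (duration \<delta> ?S + (snd c + \<delta>)) / W)"
    using step.IH greedy_choice_served_ge[OF assms(2,3,5,6) cs T R step.hyps(3)]
      served_unserved_nonneg[OF c0] assms(6)
    by (intro gap_contraction) auto
  ultimately show ?case
    using cs cc schedule_value_add_mset[OF assms(2,3) cc, of D ?S] by (auto simp: ac_simps)
qed

lemma greedy_output_ge:
  assumes "finite A" "finite B" "\<And>e. e \<in> A \<times> B \<Longrightarrow> 0 \<le> D e" "\<delta> > 0" "W > 0"
    and out: "greedy_output A B D \<delta> W S" and T: "feasible_schedule A B \<delta> W T"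
  shows "schedule_value A B D S \<ge> (1 - exp (- (W - \<delta>) / W)) * schedule_value A B D T"
proof -
  obtain cs R where cs: "greedy_reach A B D \<delta> W cs R" "\<not> duration \<delta> (mset cs) \<le> W"
    "S = truncate_last \<delta> W cs"
    using out by (auto simp: greedy_output_def)
  from cs(1) obtain cs' R' c where cs': "cs = cs' @ [c]" "greedy_reach A B D \<delta> W cs' R'"
    "greedy_choice A B \<delta> R' c"
    \<comment> \<open>The run is nonempty, since the empty schedule has duration
      \<open>0 \<le> W\<close>.\<close>
    by cases (use cs(2) assms(5) in auto)
  let ?P = "mset cs'" and ?v = "schedule_value A B D"
  define \<beta> where "\<beta> = W - \<delta> - duration \<delta> ?P"
  have S: "S = (if \<beta> \<ge> 0 then add_mset (fst c, \<beta>) ?P else ?P)"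
    using cs(2,3) by (auto simp: truncate_last_def cs'(1) \<beta>_def Let_def)
  have P: "\<forall>c\<in>#?P. configuration A B c" "\<And>e. e \<in> A \<times> B \<Longrightarrow> R' e = unserved D ?P e"
    "?v T - ?v ?P \<le> ?v T * exp (- duration \<delta> ?P / W)"
    using greedy_reach_invariant[OF cs'(2) assms(1-5) T] by auto
  have vT: "0 \<le> ?v T"
    using T assms(3) by (intro schedule_value_nonneg) (auto simp: feasible_schedule_def)
  have "?v T - ?v S \<le> ?v T * exp (- (W - \<delta>) / W)"
  proof (cases "\<beta> \<ge> 0")
    case True
    have "configuration A B c" using cs'(3) by (simp add: greedy_choice_def is_arg_max_def)
    then have c: "configuration A B (fst c, \<beta>)" "0 \<le> snd c"
      using True by (auto simp: configuration_def)
    \<comment> \<open>The untruncated last configuration overshoots the window.\<close>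
    have "\<beta> \<le> snd c" using cs(2) by (simp add: \<beta>_def cs'(1))
    then have "served (unserved D ?P) (fst c, \<beta>) \<ge> \<beta> / (snd c + \<delta>) * served (unserved D ?P) c"
      using True assms(4) by (intro served_truncate_ge) (auto simp: unserved_nonneg)
    moreover have "\<beta> / (snd c + \<delta>) * served (unserved D ?P) c
        \<ge> \<beta> / (snd c + \<delta>) * ((snd c + \<delta>) / W * (?v T - ?v ?P))"
      using greedy_choice_served_ge[OF assms(1,2,4,5) P(1) T P(2) cs'(3)] True c(2) assms(4)
      by (intro mult_left_mono) auto
    moreover have "\<beta> / (snd c + \<delta>) * ((snd c + \<delta>) / W * (?v T - ?v ?P)) = \<beta> / W * (?v T - ?v ?P)"
      using c(2) assms(4) by simp
    ultimately have "served (unserved D ?P) (fst c, \<beta>) \<ge> \<beta> / W * (?v T - ?v ?P)"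
      by linarith
    \<comment> \<open>Contraction with \<open>\<tau> = \<beta>\<close>; by the choice of \<beta>,
      \<open>duration \<delta> ?P + \<beta>\<close> equals \<open>W - \<delta>\<close>.\<close>
    then have "?v T - ?v ?P - served (unserved D ?P) (fst c, \<beta>)
        \<le> ?v T * exp (- (duration \<delta> ?P + \<beta>) / W)"
      using P(3) vT assms(5) True by (intro gap_contraction served_unserved_nonneg) auto
    then show ?thesis
      using True schedule_value_add_mset[OF assms(1,2) c(1), of D ?P] by (simp add: S \<beta>_def)
  next
    case False
    \<comment> \<open>Without its last configuration the run already lasts longer than
      \<open>W - \<delta>\<close>.\<close>
    then have "?v T * exp (- duration \<delta> ?P / W) \<le> ?v T * exp (- (W - \<delta>) / W)"
      using vT assms(5) by (intro mult_left_mono) (auto simp: \<beta>_def field_simps)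
    then show ?thesis using False P(3) by (simp add: S)
  qed
  then show ?thesis by (simp add: algebra_simps)
qed

section \<open>The numerical estimate and short windows\<close>

lemma exp_window_loss_bound:
  fixes x :: real
  assumes "0 \<le> x" "x \<le> 1 / 2"
  shows "(1 - 2 * x) * (1 - 1 / exp 1) \<le> 1 - exp (x - 1)"
proof -
  \<comment> \<open>The product is \<open>1 + x * (1 - 2 * x)\<close>, which is where
    \<open>x \<le> 1 / 2\<close> enters. It gives \<open>exp x \<le> 1 + 2 * x\<close>, the source
    of the factor 2 in the theorem.\<close>
  have "1 \<le> (1 - x) * (1 + 2 * x)"
    using assms mult_left_mono[of x "1/2" x] by (simp add: algebra_simps)
  also have "\<dots> \<le> exp (- x) * (1 + 2 * x)"
    using exp_ge_add_one_self[of "- x"] assms(1) by (intro mult_right_mono) auto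
  finally have "exp x \<le> 1 + 2 * x" by (simp add: exp_minus field_simps)
  also have "\<dots> \<le> 1 + 2 * x * (exp 1 - 1)"
    using exp_ge_add_one_self[of 1] mult_left_mono[of 1 "exp 1 - 1" "2 * x"] assms(1) by simp
  finally have "exp x / exp 1 \<le> (1 + 2 * x * (exp 1 - 1)) / exp 1"
    by (intro divide_right_mono) auto
  also have "\<dots> = 1 - (1 - 2 * x) * (1 - 1 / exp 1)" by (simp add: field_simps)
  finally show ?thesis by (simp add: exp_diff)
qed

lemma feasible_schedule_zero_window:
  assumes "\<delta> > 0" "feasible_schedule A B \<delta> 0 S"
  shows "S = {#}"
proof (cases S)
  case (add c T)
  have "0 \<le> duration \<delta> T" if "\<forall>c\<in>#T. configuration A B c" for T :: "'a config multiset"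
    using that assms(1) by (induction T) (auto simp: configuration_def)
  then show ?thesis using assms add by (force simp: feasible_schedule_def configuration_def)
qed

text \<open>Makes the output's value nonnegative, which settles the windows below
  \<open>2 * \<delta>\<close>. Truncation keeps the matching and is done only for
  \<open>\<beta> \<ge> 0\<close>.\<close>

lemma greedy_output_configuration:
  assumes "greedy_output A B D \<delta> W S" "W \<ge> 0"
  shows "\<forall>c\<in>#S. configuration A B c"
proof -
  have *: "\<forall>c\<in>#mset cs. configuration A B c" if "greedy_reach A B D \<delta> W cs R" for cs R
    using that by induction (auto simp: greedy_choice_def is_arg_max_def)
  obtain cs R where cs: "greedy_reach A B D \<delta> W cs R" "\<not> duration \<delta> (mset cs) \<le> W"
    "S = truncate_last \<delta> W cs"
    using assms(1) by (auto simp: greedy_output_def)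
  have "cs \<noteq> []" using cs(2) assms(2) by auto
  then have "configuration A B (last cs)" using *[OF cs(1)] by simp
  then show ?thesis
    using *[OF cs(1)] unfolding cs(3) truncate_last_def Let_def
    by (auto simp: configuration_def dest: in_set_butlastD)
qed

theorem theorem4:
  fixes A B :: "'v set" and D :: "'v \<times> 'v \<Rightarrow> real" and \<delta> W :: real
    and S\<^sub>r Opt :: "'v config multiset"
  assumes "finite A" and "finite B" and "A \<inter> B = {}"
    and "\<And>e. e \<in> A \<times> B \<Longrightarrow> 0 \<le> D e"
    and "\<delta> > 0" and "W \<ge> 0"
    and "greedy_output A B D \<delta> W S\<^sub>r"
    and "optimal_schedule A B D \<delta> W Opt"
  shows "schedule_value A B D S\<^sub>r \<ge>
    (1 - 2 * \<delta> / W) * (1 - 1 / exp 1) * schedule_value A B D Opt"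
proof -
  let ?v = "schedule_value A B D"
  have Opt: "feasible_schedule A B \<delta> W Opt"
    using assms(8) by (simp add: optimal_schedule_def is_arg_max_def)
  have Opt0: "0 \<le> ?v Opt"
    using Opt assms(4) by (intro schedule_value_nonneg) (auto simp: feasible_schedule_def)
  have Sr0: "0 \<le> ?v S\<^sub>r"
    using assms(4) greedy_output_configuration[OF assms(7,6)] by (intro schedule_value_nonneg) auto
  consider "W = 0" | "0 < W" "W < 2 * \<delta>" | "2 * \<delta> \<le> W" "0 < W"
    using assms(6) by linarith
  then show ?thesis
  proof cases
    \<comment> \<open>Here \<open>2 * \<delta> / W\<close> is \<open>0\<close>, but nothing can be scheduled.\<close>
    case 1
    then have "Opt = {#}" using feasible_schedule_zero_window[OF assms(5)] Opt by simp
    then have "?v Opt = 0" using assms(4) by (auto simp: schedule_value_load intro!: sum.neutral)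
    then show ?thesis using Sr0 by simp
  next
    case 2
    \<comment> \<open>The first factor is negative here, so the claimed bound is at most 0.\<close>
    then have "(1 - 2 * \<delta> / W) * (1 - 1 / exp 1) \<le> 0"
      by (intro mult_nonpos_nonneg) (auto simp: field_simps)
    then have "(1 - 2 * \<delta> / W) * (1 - 1 / exp 1) * ?v Opt \<le> 0"
      using Opt0 by (rule mult_nonpos_nonneg)
    then show ?thesis using Sr0 by linarith
  next
    case 3
    have "(1 - 2 * (\<delta> / W)) * (1 - 1 / exp 1) \<le> 1 - exp (\<delta> / W - 1)"
      using 3 assms(5) by (intro exp_window_loss_bound) (auto simp: field_simps)
    also have "\<delta> / W - 1 = - (W - \<delta>) / W" using 3 by (simp add: field_simps)
    finally have "(1 - 2 * \<delta> / W) * (1 - 1 / exp 1) * ?v Opt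
        \<le> (1 - exp (- (W - \<delta>) / W)) * ?v Opt"
      using Opt0 by (intro mult_right_mono) auto
    also have "\<dots> \<le> ?v S\<^sub>r"
      using assms 3 Opt by (intro greedy_output_ge) auto
    finally show ?thesis .
  qed
qed

end
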